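(* Let $p$ be a prime number. For any integers $1 \leq a \leq p-1$, $0 \leq m \leq p-1$ and $0 \leq n \leq p-1$, we have the following congruence modulo $p$: $$\sum_{\substack{k=1 \\ k \neq a}}^{p-1} \frac{k^m}{(a-k)^n} \equiv \begin{cases} -a^{p-1-n}, & \text{if } m=0 \text{ and } n \in \{1, 2, \ldots, p-2\},\\ -a^m, & \text{if } n=p-1 \text{ and } m \in \{1, 2, \ldots, p-2\},\\ -2, & \text{if } m, n \in \{0, p-1\},\\ (-1)^{n+1}a^{m-n} \binom{m}{n}, & \text{otherwise}. \end{cases}$$
   Context: Congruences are in $\mathbb{Z}/p\mathbb{Z}$: a quotient $x/y$ with $p \nmid y$ means $x$ times the inverse of $y$ modulo $p$, and negative powers of integers prime to $p$ are interpreted likewise. Zeroth powers equal $1$. Binomial coefficients $\binom{u}{v}$ are $0$ unless $0 \le v \le u$. *)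

theory Defs
  imports "HOL-Number_Theory.Number_Theory" "HOL-Number_Theory.Modular_Inverse"
begin

text \<open>Quotients and integer powers modulo \<open>p\<close>, as integer representatives of the residue classes.
  They are only meaningful up to congruence modulo \<open>p\<close>, and only when \<open>y\<close>
  (resp. \<open>x\<close>, if the exponent is negative) is coprime to \<open>p\<close>.\<close>

definition mod_quot :: "int \<Rightarrow> int \<Rightarrow> int \<Rightarrow> int" where
  "mod_quot p x y = x * modular_inverse p y"

definition mod_powi :: "int \<Rightarrow> int \<Rightarrow> int \<Rightarrow> int" where
  "mod_powi p x e = (if e \<ge> 0 then x ^ nat e else modular_inverse p (x ^ nat (- e)))"

end

theory Submission
  imports Defs
begin

text \<open>
  By Fermat's little theorem, dividing by \<open>(a - k) ^ n\<close> is the same as multiplying by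
  \<open>(a - k) ^ (p - 1 - n)\<close>, so the sum of quotients becomes the sum of a polynomial in \<open>k\<close>.
  A polynomial can be summed over a whole system of residues modulo \<open>p\<close>: the power sum
  \<open>\<Sum>k. k ^ s\<close> is \<open>-1\<close> if \<open>s\<close> is a positive multiple of \<open>p - 1\<close> and vanishes otherwise
  (\<open>sum_residues_power\<close>). Here the reflection \<open>k \<mapsto> a - k\<close> and the binomial theorem
  turn the polynomial into a combination of the powers with exponents
  \<open>p - 1 - n + i\<close>, \<open>0 \<le> i \<le> m\<close>. Only \<open>i = n\<close> gives a nonzero power sum, and this term is
  \<open>(-1) ^ (n + 1) a ^ (m - n) (m choose n)\<close> (\<open>sum_residues_power_mult_power\<close>). The single
  exception is \<open>m = p - 1\<close>, \<open>n = 0\<close>, where \<open>i = p - 1\<close> also contributes.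

  The sum of quotients differs from the complete one by the terms with \<open>k = 0\<close> and \<open>k = a\<close>,
  which are \<open>0 ^ m a ^ (p - 1 - n)\<close> and \<open>a ^ m 0 ^ (p - 1 - n)\<close>. They are nonzero only for
  \<open>m = 0\<close> and for \<open>n = p - 1\<close> respectively. Unless \<open>m\<close> and \<open>n\<close> both lie in \<open>{0, p - 1}\<close>,
  at most one of these equations holds, and it implies \<open>m < n\<close>, so that the binomial coefficient
  is \<open>0\<close> and only the omitted term remains; these are the first two cases of the theorem.
  If \<open>m\<close> and \<open>n\<close> both lie in \<open>{0, p - 1}\<close>, then Fermat's theorem makes all \<open>p - 2\<close>
  quotients congruent to \<open>1\<close>.
\<close>

lemma fermat_theorem_int:
  fixes x :: int
  assumes "prime p" and "coprime x (int p)"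
  shows "[x ^ (p - 1) = 1] (mod (int p))"
proof -
  define y where "y = nat (x mod int p)"
  have p0: "int p > 0" using assms(1) prime_gt_0_nat by simp
  have y: "int y = x mod int p" using p0 by (simp add: y_def)
  have xy: "[x = int y] (mod (int p))" by (simp add: y)
  have "\<not> int p dvd x"
    using assms by (metis coprime_absorb_right not_prime_unit prime_nat_int_transfer)
  hence "\<not> p dvd y"
    using xy cong_dvd_iff int_dvd_int_iff cong_0_iff cong_trans by blast
  hence "[y ^ (p - 1) = 1] (mod p)" by (rule fermat_theorem[OF assms(1)])
  hence "[int y ^ (p - 1) = 1] (mod (int p))"
    by (metis cong_int_iff of_nat_1 of_nat_power)
  thus ?thesis using cong_pow[OF xy] cong_trans by blast
qed

text \<open>A map that is injective modulo \<open>q\<close> permutes the residue classes, so it does not change a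
  sum over all of them. This is used for scalings and for reflections.\<close>

lemma sum_residues_reindex:
  fixes f h :: "int \<Rightarrow> int" and q :: int
  assumes "q > 0"
    and f: "\<And>x y. [x = y] (mod q) \<Longrightarrow> [f x = f y] (mod q)"
    and h: "\<And>x y. [h x = h y] (mod q) \<Longrightarrow> [x = y] (mod q)"
  shows "[(\<Sum>k\<in>{0..<q}. f (h k)) = (\<Sum>k\<in>{0..<q}. f k)] (mod q)"
proof -
  have inj: "inj_on (\<lambda>k. h k mod q) {0..<q}"
  proof (rule inj_onI)
    fix x y assume "x \<in> {0..<q}" "y \<in> {0..<q}" "h x mod q = h y mod q"
    thus "x = y" using h[of x y] by (intro cong_less_imp_eq_int[of x q y]) (auto simp: cong_def)
  qed
  have "(\<lambda>k. h k mod q) ` {0..<q} = {0..<q}"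
    using assms(1) by (intro endo_inj_surj inj) auto
  hence bij: "bij_betw (\<lambda>k. h k mod q) {0..<q} {0..<q}" using inj by (simp add: bij_betw_def)
  have "[(\<Sum>k\<in>{0..<q}. f (h k)) = (\<Sum>k\<in>{0..<q}. f (h k mod q))] (mod q)"
    by (intro cong_sum f) simp
  also have "(\<Sum>k\<in>{0..<q}. f (h k mod q)) = (\<Sum>k\<in>{0..<q}. f k)"
    by (rule sum.reindex_bij_betw[OF bij])
  finally show ?thesis .
qed

text \<open>If \<open>p - 1\<close> does not divide \<open>s\<close>, then a primitive root \<open>g\<close> satisfies \<open>g ^ s \<noteq> 1\<close>. The
  scaling \<open>k \<mapsto> g * k\<close> multiplies the power sum by \<open>g ^ s\<close> without changing it, so the power sum
  vanishes. Otherwise, Fermat's theorem evaluates each term. For \<open>s = 0\<close> the convention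
  \<open>0 ^ 0 = 1\<close> gives \<open>p\<close> terms equal to \<open>1\<close>, and the sum vanishes again.\<close>

lemma sum_residues_power:
  assumes "prime p"
  shows "[(\<Sum>k\<in>{0..<int p}. k ^ s) = (if s > 0 \<and> (p - 1) dvd s then -1 else 0)] (mod (int p))"
proof -
  have p1: "p > 1" using assms prime_gt_1_nat by blast
  have split: "{0..<int p} = insert 0 {1..<int p}" using p1 by auto
  consider "s = 0" | "s > 0" "(p - 1) dvd s" | "\<not> (p - 1) dvd s" by auto
  thus ?thesis
  proof cases
    case 1
    thus ?thesis by (simp add: cong_def)
  next
    case 2
    then obtain r where r: "s = (p - 1) * r" by auto
    have "[(\<Sum>k\<in>{1..<int p}. k ^ s) = (\<Sum>k\<in>{1..<int p}. 1)] (mod (int p))"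
    proof (rule cong_sum)
      fix k assume "k \<in> {1..<int p}"
      hence "\<not> int p dvd k" by (auto dest: zdvd_imp_le)
      hence "coprime k (int p)"
        using assms by (metis coprime_commute prime_imp_coprime prime_nat_int_transfer)
      from cong_pow[OF fermat_theorem_int[OF assms this], of r]
      show "[k ^ s = 1] (mod (int p))" by (simp add: r power_mult)
    qed
    also have "(\<Sum>k\<in>{1..<int p}. 1) = int p - 1" using p1 by simp
    also have "[int p - 1 = - 1] (mod (int p))" by (simp add: cong_iff_dvd_diff)
    finally show ?thesis using 2 by (simp add: split zero_power)
  next
    case 3
    obtain g where "residue_primroot p g" using prime_primitive_root_exists[of p] assms p1 by auto
    hence g: "coprime p g" "ord p g = p - 1"
      using assms by (auto simp: residue_primroot_def totient_prime)
    have cop: "coprime (int g) (int p)" using g(1) by (simp add: coprime_commute)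
    have "\<not> [g ^ s = 1] (mod p)" using g(2) 3 ord_divides[of g s p] by simp
    hence "\<not> [int g ^ s = 1] (mod (int p))"
      by (metis cong_int_iff of_nat_1 of_nat_power)
    hence ndvd: "\<not> int p dvd (int g ^ s - 1)" by (simp add: cong_iff_dvd_diff)
    have "[(\<Sum>k\<in>{0..<int p}. (int g * k) ^ s) = (\<Sum>k\<in>{0..<int p}. k ^ s)] (mod (int p))"
      using p1 cop by (intro sum_residues_reindex cong_pow) (simp_all add: cong_mult_lcancel)
    hence "int p dvd (int g ^ s - 1) * (\<Sum>k\<in>{0..<int p}. k ^ s)"
      by (simp add: power_mult_distrib cong_iff_dvd_diff left_diff_distrib flip: sum_distrib_left)
    hence "int p dvd (\<Sum>k\<in>{0..<int p}. k ^ s)"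
      using ndvd assms by (simp add: prime_dvd_mult_iff)
    thus ?thesis using 3 by (auto simp: cong_0_iff)
  qed
qed

text \<open>After the reflection \<open>k \<mapsto> a - k\<close> the power of \<open>a - k\<close> is expanded. The exponents
  \<open>p - 1 - n + i\<close> lie between \<open>0\<close> and \<open>2 * (p - 1)\<close>, so the only possible positive multiples of
  \<open>p - 1\<close> among them belong to \<open>i = n\<close> and to \<open>i = p - 1 + n\<close>; the latter forces \<open>m = p - 1\<close> and
  \<open>n = 0\<close>. If \<open>n > m\<close>, then \<open>i = n\<close> is out of range; the binomial coefficient is \<open>0\<close> and
  the truncated exponent \<open>m - n\<close> does no harm.\<close>

lemma sum_residues_power_mult_power:
  fixes a :: int
  assumes "prime p" and "m \<le> p - 1" and "n \<le> p - 1" and exc: "\<not> (m = p - 1 \<and> n = 0)"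
  shows "[(\<Sum>k\<in>{0..<int p}. k ^ m * (a - k) ^ (p - 1 - n)) =
          (-1) ^ (n + 1) * a ^ (m - n) * int (m choose n)] (mod (int p))"
proof -
  define N where "N = p - 1 - n"
  define c where "c s = (if s > 0 \<and> (p - 1) dvd s then -1 else 0 :: int)" for s :: nat
  have p1: "p > 1" using assms prime_gt_1_nat by blast
  have c: "c (N + i) = (if i = n then -1 else 0)" if "i \<le> m" for i
  proof (cases "N + i > 0 \<and> (p - 1) dvd (N + i)")
    case True
    then obtain r where r: "N + i = (p - 1) * r" by auto
    have "r > 0" using True r by (cases r) auto
    have "r < 2"
    proof (rule ccontr)
      assume "\<not> r < 2"
      hence "(p - 1) * 2 \<le> N + i" using r by simp
      thus False using that assms(2,3) exc p1 unfolding N_def by auto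
    qed
    with \<open>r > 0\<close> have "r = 1" by simp
    hence "i = n" using r assms(3) by (auto simp: N_def)
    thus ?thesis using True by (auto simp: c_def)
  next
    case False
    have "i \<noteq> n" using False assms(3) p1 by (auto simp: N_def)
    thus ?thesis using False by (auto simp: c_def)
  qed
  have "[(\<Sum>k\<in>{0..<int p}. k ^ m * (a - k) ^ N) =
         (\<Sum>k\<in>{0..<int p}. (a - k) ^ m * (a - (a - k)) ^ N)] (mod (int p))"
  proof (rule cong_sym, rule sum_residues_reindex)
    fix x y :: int assume "[a - x = a - y] (mod (int p))"
    from cong_diff[OF cong_refl[of a] this] show "[x = y] (mod (int p))" by simp
  qed (use p1 in \<open>auto intro!: cong_mult cong_pow cong_diff\<close>)
  also have "(\<Sum>k\<in>{0..<int p}. (a - k) ^ m * (a - (a - k)) ^ N) =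
      (\<Sum>k\<in>{0..<int p}. \<Sum>i\<le>m. int (m choose i) * (-1) ^ i * a ^ (m - i) * k ^ (N + i))"
  proof (rule sum.cong[OF refl])
    fix k :: int
    have "(a - k) ^ m = (\<Sum>i\<le>m. int (m choose i) * (-k) ^ i * a ^ (m - i))"
      using binomial_ring[of "-k" a m] by simp
    thus "(a - k) ^ m * (a - (a - k)) ^ N =
        (\<Sum>i\<le>m. int (m choose i) * (-1) ^ i * a ^ (m - i) * k ^ (N + i))"
      by (simp add: sum_distrib_left sum_distrib_right power_add power_minus[of k] mult_ac)
  qed
  also have "\<dots> = (\<Sum>i\<le>m. int (m choose i) * (-1) ^ i * a ^ (m - i) *
      (\<Sum>k\<in>{0..<int p}. k ^ (N + i)))"
    by (subst sum.swap) (simp add: sum_distrib_left)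
  also have "[\<dots> = (\<Sum>i\<le>m. int (m choose i) * (-1) ^ i * a ^ (m - i) * c (N + i))] (mod (int p))"
    unfolding c_def using assms(1) by (intro cong_sum cong_mult cong_refl sum_residues_power)
  also have "(\<Sum>i\<le>m. int (m choose i) * (-1) ^ i * a ^ (m - i) * c (N + i)) =
      (\<Sum>i\<le>m. if i = n then int (m choose i) * (-1) ^ (i + 1) * a ^ (m - i) else 0)"
    by (intro sum.cong) (auto simp: c)
  also have "\<dots> = (-1) ^ (n + 1) * a ^ (m - n) * int (m choose n)"
    by (simp add: sum.delta binomial_eq_0)
  finally show ?thesis by (simp add: N_def)
qed

lemma modular_inverse_power_cong:
  fixes x :: int
  assumes "prime p" and "coprime x (int p)" and "n \<le> p - 1"
  shows "[modular_inverse (int p) (x ^ n) = x ^ (p - 1 - n)] (mod (int p))"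
proof -
  have cop: "coprime (x ^ n) (int p)" using assms(2) by simp
  have "[x ^ n * modular_inverse (int p) (x ^ n) = 1] (mod (int p))"
    by (rule cong_modular_inverse1[OF cop])
  also have "[1 = x ^ n * x ^ (p - 1 - n)] (mod (int p))"
    using cong_sym[OF fermat_theorem_int[OF assms(1,2)]] assms(3)
    by (metis le_add_diff_inverse power_add)
  finally show ?thesis using cop by (simp add: cong_mult_lcancel)
qed

theorem theorem2p1:
  fixes p m n :: nat and a :: int
  assumes "prime p"
    and "1 \<le> a" and "a \<le> int p - 1"
    and "m \<le> p - 1" and "n \<le> p - 1"
  shows "[(\<Sum>k \<in> {1..int p - 1} - {a}. mod_quot (int p) (k ^ m) ((a - k) ^ n)) =
          (if m = 0 \<and> n \<in> {1..p - 2} then - (a ^ (p - 1 - n))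
           else if n = p - 1 \<and> m \<in> {1..p - 2} then - (a ^ m)
           else if m \<in> {0, p - 1} \<and> n \<in> {0, p - 1} then - 2
           else (- 1) ^ (n + 1) * mod_powi (int p) a (int m - int n) * int (m choose n))]
         (mod (int p))"
    (is "[?S = ?R] (mod _)")
proof -
  define N where "N = p - 1 - n"
  define f where "f k = k ^ m * (a - k) ^ N" for k :: int
  let ?K = "{1..int p - 1} - {a}"
  have p1: "p > 1" using assms prime_gt_1_nat by blast
  have cop: "coprime k (int p)" "coprime (a - k) (int p)" if "k \<in> ?K" for k
  proof -
    have "\<not> int p dvd k" using that by (auto dest: zdvd_imp_le)
    moreover have "\<not> int p dvd a - k"
      using that assms(2,3) dvd_imp_le_int[of "a - k" "int p"] by auto
    ultimately show "coprime k (int p)" "coprime (a - k) (int p)"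
      using assms(1) by (metis coprime_commute prime_imp_coprime prime_nat_int_transfer)+
  qed
  have S: "[?S = (\<Sum>k\<in>?K. f k)] (mod (int p))"
    unfolding mod_quot_def f_def N_def
    by (intro cong_sum cong_mult cong_refl modular_inverse_power_cong assms cop)
  show ?thesis
  proof (cases "m \<in> {0, p - 1} \<and> n \<in> {0, p - 1}")
    case True
    \<comment> \<open>\<open>N = p - 1 - n\<close> lies in \<open>{0, p - 1}\<close> as well, so both factors of \<open>f k\<close> are \<open>1\<close>.\<close>
    have one: "[x ^ e = 1] (mod (int p))" if "coprime x (int p)" "e \<in> {0, p - 1}" for x e
      using fermat_theorem_int[OF assms(1) that(1)] that(2) by auto
    have N: "N \<in> {0, p - 1}" using True by (auto simp: N_def)
    have "[(\<Sum>k\<in>?K. f k) = (\<Sum>k\<in>?K. 1 * 1)] (mod (int p))"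
      unfolding f_def using True N by (intro cong_sum cong_mult one cop) auto
    also have "(\<Sum>k\<in>?K. 1 * 1) = int p - 2"
      using assms(2,3) p1 by (simp add: card_Diff_singleton of_nat_diff)
    also have "[int p - 2 = - 2] (mod (int p))" by (simp add: cong_iff_dvd_diff)
    also have "- 2 = ?R" using True p1 by auto
    finally show ?thesis using S cong_trans by blast
  next
    case False
    have "(\<Sum>k\<in>{0..<int p}. f k) = f 0 + (f a + (\<Sum>k\<in>?K. f k))"
    proof -
      have "{0..<int p} = insert 0 {1..int p - 1}" using p1 by auto
      thus ?thesis using assms(2,3) sum.remove[of "{1..int p - 1}" a f] by simp
    qed
    hence "(\<Sum>k\<in>?K. f k) = (\<Sum>k\<in>{0..<int p}. f k) - (0 ^ m * a ^ N + a ^ m * 0 ^ N)"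
      by (simp add: f_def)
    also have "[\<dots> = (-1) ^ (n + 1) * a ^ (m - n) * int (m choose n)
                    - (0 ^ m * a ^ N + a ^ m * 0 ^ N)] (mod (int p))"
      unfolding f_def N_def using assms False
      by (intro cong_diff cong_refl sum_residues_power_mult_power) auto
    also have "(-1) ^ (n + 1) * a ^ (m - n) * int (m choose n)
        - (0 ^ m * a ^ N + a ^ m * 0 ^ N) = ?R"
    proof -
      consider "m = 0" "n \<in> {1..p - 2}" | "n = p - 1" "m \<in> {1..p - 2}"
        | "m > 0" "n < p - 1"
        using False assms(4,5) by fastforce
      thus ?thesis
      proof cases
        case 3
        hence "N > 0" by (simp add: N_def)
        moreover have "a ^ (m - n) * int (m choose n) =
            mod_powi (int p) a (int m - int n) * int (m choose n)"
          by (cases "n \<le> m") (auto simp: mod_powi_def nat_diff_distrib binomial_eq_0)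
        ultimately show ?thesis using 3 False by (auto simp: mult.assoc binomial_eq_0 zero_power)
      qed (auto simp: N_def binomial_eq_0)
    qed
    finally show ?thesis using S cong_trans by blast
  qed
qed

end
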